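(* Let $(X,D)$ be an $\mathcal{F}$-metric space with respect to $(f,\alpha)\in\mathcal{F}\times[0,\infty)$. Then $X$ is metrizable; that is, there exists a metric $d:X\times X\to[0,\infty)$ on $X$ such that the topology generated by $d$ equals the topology $\tau_F$ generated by $D$.
   Context: Let $\mathcal{F}$ be the set of all functions $f:(0,\infty)\to\mathbb{R}$ satisfying: ($\mathcal{F}_1$) $f$ is non-decreasing, i.e. $0<s<t$ implies $f(s)\le f(t)$; ($\mathcal{F}_2$) for every sequence $\{t_n\}_{n\in\mathbb{N}}\subseteq(0,\infty)$, $\lim_{n\to\infty}t_n=0$ if and only if $\lim_{n\to\infty}f(t_n)=-\infty$. Let $X$ be a non-empty set, $D:X\times X\to[0,\infty)$ a mapping and $(f,\alpha)\in\mathcal{F}\times[0,\infty)$. The pair $(X,D)$ is an $\mathcal{F}$-metric space with respect to $(f,\alpha)$ (and $D$ is an $\mathcal{F}$-metric on $X$) if: (D1) for all $(x,y)\in X\times X$, $D(x,y)=0$ if and only if $x=y$; (D2) $D(x,y)=D(y,x)$ for all $(x,y)\in X\times X$; (D3) for every $(x,y)\in X\times X$, every $N\in\mathbb{N}$ with $N\ge 2$, and every $(u_i)_{i=1}^N\subseteq X$ with $(u_1,u_N)=(x,y)$: if $D(x,y)>0$, then $f(D(x,y))\le f\left(\sum_{i=1}^{N-1}D(u_i,u_{i+1})\right)+\alpha$. For $x\in X$ and $r>0$ put $B_D(x,r)=\{y\in X: D(x,y)<r\}$. The topology $\tau_F$ generated by $D$ consists of all subsets $V\subseteq X$ such that for every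 $x\in V$ there exists $r>0$ with $B_D(x,r)\subseteq V$. *)

theory Defs
  imports "HOL-Analysis.Analysis"
begin

text \<open>Functions on \<open>(0,\<infinity>)\<close> are represented by total functions on the reals of which only the
  values at positive arguments are constrained.\<close>

definition F_functions :: "(real \<Rightarrow> real) set" where
  "F_functions =
     {f. (\<forall>s t. 0 < s \<longrightarrow> s < t \<longrightarrow> f s \<le> f t) \<and>
         (\<forall>t :: nat \<Rightarrow> real. (\<forall>n. 0 < t n) \<longrightarrow>
            (t \<longlonglongrightarrow> 0 \<longleftrightarrow> filterlim (\<lambda>n. f (t n)) at_bot sequentially))}"

text \<open>In the chain condition both arguments of \<open>f\<close> are positive: if \<open>D x y > 0\<close> then \<open>x \<noteq> y\<close>, so
  some link of the chain joins two distinct points.\<close>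

locale F_metric_space =
  fixes X :: "'a set" and D :: "'a \<Rightarrow> 'a \<Rightarrow> real"
    and f :: "real \<Rightarrow> real" and \<alpha> :: real
  assumes nonempty: "X \<noteq> {}"
    and f_in: "f \<in> F_functions"
    and alpha_nonneg: "0 \<le> \<alpha>"
    and nonneg: "\<lbrakk>x \<in> X; y \<in> X\<rbrakk> \<Longrightarrow> 0 \<le> D x y"
    and zero: "\<lbrakk>x \<in> X; y \<in> X\<rbrakk> \<Longrightarrow> D x y = 0 \<longleftrightarrow> x = y"
    and commute: "\<lbrakk>x \<in> X; y \<in> X\<rbrakk> \<Longrightarrow> D x y = D y x"
    and chain: "\<And>x y (N :: nat) (u :: nat \<Rightarrow> 'a).
      \<lbrakk>x \<in> X; y \<in> X; 2 \<le> N; \<forall>i\<in>{1..N}. u i \<in> X; u 1 = x; u N = y; 0 < D x y\<rbrakk>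
      \<Longrightarrow> f (D x y) \<le> f (\<Sum>i=1..N-1. D (u i) (u (i + 1))) + \<alpha>"

definition F_ball :: "'a set \<Rightarrow> ('a \<Rightarrow> 'a \<Rightarrow> real) \<Rightarrow> 'a \<Rightarrow> real \<Rightarrow> 'a set" where
  "F_ball X D x r = {y \<in> X. D x y < r}"

definition F_open :: "'a set \<Rightarrow> ('a \<Rightarrow> 'a \<Rightarrow> real) \<Rightarrow> 'a set \<Rightarrow> bool" where
  "F_open X D V \<longleftrightarrow> V \<subseteq> X \<and> (\<forall>x\<in>V. \<exists>r>0. F_ball X D x r \<subseteq> V)"

definition F_topology :: "'a set \<Rightarrow> ('a \<Rightarrow> 'a \<Rightarrow> real) \<Rightarrow> 'a topology" where
  "F_topology X D = topology (F_open X D)"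

lemma istopology_F_open: "istopology (F_open X D)"
  unfolding istopology_def
proof (intro conjI allI impI)
  fix S T assume S: "F_open X D S" and T: "F_open X D T"
  show "F_open X D (S \<inter> T)"
    unfolding F_open_def
  proof (intro conjI ballI)
    show "S \<inter> T \<subseteq> X" using S by (auto simp: F_open_def)
    fix x assume "x \<in> S \<inter> T"
    then obtain r s where "r > 0" "F_ball X D x r \<subseteq> S" "s > 0" "F_ball X D x s \<subseteq> T"
      using S T unfolding F_open_def by blast
    then show "\<exists>r>0. F_ball X D x r \<subseteq> S \<inter> T"
      by (intro exI[of _ "min r s"]) (auto simp: F_ball_def)
  qed
next
  fix \<K> assume "\<forall>K\<in>\<K>. F_open X D K"
  then show "F_open X D (\<Union>\<K>)"
    unfolding F_open_def by (meson Sup_least UnionE Union_upper order_trans)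
qed

lemma openin_F_topology: "openin (F_topology X D) V \<longleftrightarrow> F_open X D V"
  by (simp add: F_topology_def istopology_F_open)

end

theory Submission
  imports Defs
begin

text \<open>
  The metric is the chain metric of \<open>D\<close>: \<open>d x y\<close> is the infimum of the sums
  \<open>D u\<^sub>0 u\<^sub>1 + \<dots> + D u\<^sub>n\<^sub>-\<^sub>1 u\<^sub>n\<close> over all finite chains in \<open>X\<close> from \<open>x\<close> to \<open>y\<close>. Concatenating
  chains gives the triangle inequality, reversing them gives symmetry, and the chain with a
  single link shows \<open>d \<le> D\<close>.

  For an arbitrary symmetric \<open>D\<close> this infimum may vanish between distinct points. The chain
  condition excludes that, uniformly. Let \<open>\<epsilon> > 0\<close>. As \<open>f\<close> tends to \<open>-\<infinity>\<close> at \<open>0\<close>, there is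
  \<open>\<delta> > 0\<close> such that \<open>f t < f \<epsilon> - \<alpha>\<close> for \<open>0 < t < \<delta>\<close>. If a chain from \<open>x\<close> to \<open>y \<noteq> x\<close> has sum
  \<open>s < \<delta>\<close>, then \<open>f (D x y) \<le> f s + \<alpha> < f \<epsilon>\<close>, and monotonicity of \<open>f\<close> forces \<open>D x y < \<epsilon>\<close>
  (\<open>short_chain_imp_close\<close>). Hence \<open>d\<close> separates points, and every \<open>D\<close>-ball of radius \<open>\<epsilon>\<close>
  contains the \<open>d\<close>-ball of radius \<open>\<delta>\<close> around the same centre. Since \<open>d \<le> D\<close> gives an inclusion of
  balls in the other direction, \<open>d\<close> and \<open>D\<close> have the same open sets.
\<close>

inductive chain_sum :: "'a set \<Rightarrow> ('a \<Rightarrow> 'a \<Rightarrow> real) \<Rightarrow> 'a \<Rightarrow> 'a \<Rightarrow> real \<Rightarrow> bool"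
  for X D where
  refl: "x \<in> X \<Longrightarrow> chain_sum X D x x 0"
| step: "chain_sum X D x y s \<Longrightarrow> z \<in> X \<Longrightarrow> chain_sum X D x z (s + D y z)"

text \<open>The value \<open>0\<close> outside \<open>X\<close> is there because \<^locale>\<open>Metric_space\<close> demands nonnegativity and
  symmetry at all arguments, and the infimum of the empty set of reals is unspecified.\<close>

definition chain_metric :: "'a set \<Rightarrow> ('a \<Rightarrow> 'a \<Rightarrow> real) \<Rightarrow> 'a \<Rightarrow> 'a \<Rightarrow> real" where
  "chain_metric X D x y = (if x \<in> X \<and> y \<in> X then Inf {s. chain_sum X D x y s} else 0)"

lemma chain_sum_in_carrier:
  assumes "chain_sum X D x y s"
  shows "x \<in> X" and "y \<in> X"
  using assms by (induction) auto

lemma chain_sum_single: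
  assumes "x \<in> X" "y \<in> X"
  shows "chain_sum X D x y (D x y)"
  using chain_sum.step[OF chain_sum.refl] assms by fastforce

lemma chain_sum_concat:
  assumes "chain_sum X D y z t" "chain_sum X D x y s"
  shows "chain_sum X D x z (s + t)"
  using assms
proof induction
  case (refl y)
  then show ?case by simp
next
  case (step y w t z)
  then show ?case using chain_sum.step[of X D x w "s + t" z] by (simp add: add.assoc)
qed

text \<open>This converts the inductive presentation, which suits concatenation and reversal, into the
  indexed one of the chain condition.\<close>

lemma chain_sum_imp_sequence:
  assumes "chain_sum X D x y s"
  shows "\<exists>n u. (\<forall>i\<le>n. u i \<in> X) \<and> u 0 = x \<and> u n = y \<and> s = (\<Sum>i<n. D (u i) (u (Suc i)))"
  using assms
proof induction
  case (refl x)
  then show ?case by (intro exI[of _ 0] exI[of _ "\<lambda>_. x"]) simp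
next
  case (step x y s z)
  then obtain n u where u: "\<forall>i\<le>n. u i \<in> X" "u 0 = x" "u n = y"
    and s: "s = (\<Sum>i<n. D (u i) (u (Suc i)))" by blast
  let ?v = "u(Suc n := z)"
  have "(\<Sum>i<Suc n. D (?v i) (?v (Suc i))) = s + D y z"
    using u(3) s by (simp cong: sum.cong_simp)
  with u step.hyps show ?case
    by (intro exI[of _ "Suc n"] exI[of _ ?v]) (auto simp: le_Suc_eq)
qed

text \<open>Monotonicity carries the bound from a single term of the sequence \<open>1/n\<close> to all smaller
  arguments.\<close>

lemma F_function_below_near_zero:
  assumes "f \<in> F_functions"
  shows "\<exists>\<delta>>0. \<forall>t. 0 < t \<longrightarrow> t < \<delta> \<longrightarrow> f t < c"
proof -
  define h :: "nat \<Rightarrow> real" where "h n = inverse (real (Suc n))" for n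
  have pos: "h n > 0" for n by (simp add: h_def)
  have "h \<longlonglongrightarrow> 0" unfolding h_def by (rule LIMSEQ_inverse_real_of_nat)
  with assms pos have "filterlim (\<lambda>n. f (h n)) at_bot sequentially"
    by (auto simp: F_functions_def)
  then have "\<forall>\<^sub>F n in sequentially. f (h n) < c"
    by (simp add: filterlim_at_bot_dense)
  then obtain n where "f (h n) < c"
    by (auto simp: eventually_sequentially)
  moreover have "f t \<le> f (h n)" if "0 < t" "t < h n" for t
    using assms that by (auto simp: F_functions_def)
  ultimately show ?thesis using pos[of n] by fastforce
qed

context F_metric_space
begin

lemma chain_sum_nonneg: "chain_sum X D x y s \<Longrightarrow> 0 \<le> s"
  by (induction rule: chain_sum.induct)
    (auto intro!: add_nonneg_nonneg nonneg dest: chain_sum_in_carrier)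

lemma chain_sum_zero_imp_eq: "chain_sum X D x y s \<Longrightarrow> s = 0 \<Longrightarrow> x = y"
proof (induction rule: chain_sum.induct)
  case (step x y s z)
  have y: "y \<in> X" using step.hyps(1) by (rule chain_sum_in_carrier)
  have "0 \<le> s" using step.hyps(1) by (rule chain_sum_nonneg)
  moreover have "0 \<le> D y z" using y step.hyps(2) by (rule nonneg)
  ultimately have "s = 0" "D y z = 0" using step.prems by linarith+
  then show ?case using step.IH zero[OF y step.hyps(2)] by simp
qed simp

lemma chain_sum_reverse: "chain_sum X D x y s \<Longrightarrow> chain_sum X D y x s"
proof (induction rule: chain_sum.induct)
  case (step x y s z)
  have y: "y \<in> X" using step.hyps(1) by (rule chain_sum_in_carrier)
  have "chain_sum X D z y (D y z)"
    using chain_sum_single[of z X y D] commute y step.hyps(2) by simp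
  from chain_sum_concat[OF step.IH this] show ?case by (simp add: add.commute)
qed (rule chain_sum.refl)

lemma chain_sum_bound:
  assumes c: "chain_sum X D x y s" and "x \<noteq> y"
  shows "f (D x y) \<le> f s + \<alpha>"
proof -
  obtain n u where u: "\<forall>i\<le>n. u i \<in> X" "u 0 = x" "u n = y"
    and s: "s = (\<Sum>i<n. D (u i) (u (Suc i)))"
    using chain_sum_imp_sequence[OF c] by blast
  have xy: "x \<in> X" "y \<in> X" using chain_sum_in_carrier[OF c] .
  have "n \<noteq> 0" using u \<open>x \<noteq> y\<close> by metis
  have "0 < D x y" using nonneg[OF xy] zero[OF xy] \<open>x \<noteq> y\<close> by simp
  \<comment> \<open>The chain condition indexes the points from \<open>1\<close>, so the chain is shifted by one.\<close>
  with xy u \<open>n \<noteq> 0\<close> have "f (D x y) \<le> f (\<Sum>i=1..Suc n-1. D (u (i - 1)) (u (i + 1 - 1))) + \<alpha>"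
    by (intro chain[where u = "\<lambda>i. u (i - 1)"]) auto
  also have "(\<Sum>i=1..Suc n-1. D (u (i - 1)) (u (i + 1 - 1))) = s"
    unfolding s by (rule sum.reindex_bij_witness[of _ Suc "\<lambda>i. i - 1"]) auto
  finally show ?thesis .
qed

text \<open>The crucial estimate: \<open>\<delta>\<close> depends neither on the points nor on the number of links, which is
  what allows passing from chains to their infimum. It is chosen so that \<open>f\<close> drops below
  \<open>f \<epsilon> - \<alpha>\<close> on \<open>(0,\<delta>)\<close>.\<close>

lemma short_chain_imp_close:
  assumes "0 < \<epsilon>"
  shows "\<exists>\<delta>>0. \<forall>x y s. chain_sum X D x y s \<longrightarrow> s < \<delta> \<longrightarrow> D x y < \<epsilon>"
proof -
  obtain \<delta> where "\<delta> > 0" and \<delta>: "\<And>t. 0 < t \<Longrightarrow> t < \<delta> \<Longrightarrow> f t < f \<epsilon> - \<alpha>"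
    using F_function_below_near_zero[OF f_in] by metis
  have "D x y < \<epsilon>" if c: "chain_sum X D x y s" and "s < \<delta>" for x y s
  proof (cases "x = y")
    case True
    then show ?thesis using zero[of x x] chain_sum_in_carrier(1)[OF c] assms by simp
  next
    case False
    \<comment> \<open>Nothing is known about \<open>f 0\<close>, so the chain must be seen to have positive sum.\<close>
    have "0 < s" using chain_sum_nonneg[OF c] chain_sum_zero_imp_eq[OF c] False by linarith
    then have less: "f (D x y) < f \<epsilon>" using chain_sum_bound[OF c False] \<delta> \<open>s < \<delta>\<close> by fastforce
    have mono: "f \<epsilon> \<le> f t" if "\<epsilon> < t" for t
      using f_in assms that by (auto simp: F_functions_def)
    show ?thesis using less mono[of "D x y"] by (cases "D x y" \<epsilon> rule: linorder_cases) auto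
  qed
  with \<open>\<delta> > 0\<close> show ?thesis by blast
qed

lemma chain_metric_le_sum:
  assumes "chain_sum X D x y s"
  shows "chain_metric X D x y \<le> s"
proof -
  have "bdd_below {s. chain_sum X D x y s}"
    by (rule bdd_belowI[of _ 0]) (simp add: chain_sum_nonneg)
  then show ?thesis
    using assms chain_sum_in_carrier[OF assms] by (auto simp: chain_metric_def intro: cInf_lower)
qed

lemma chain_metric_greatest:
  assumes "x \<in> X" "y \<in> X" "\<And>s. chain_sum X D x y s \<Longrightarrow> c \<le> s"
  shows "c \<le> chain_metric X D x y"
  using assms chain_sum_single[of x X y D]
  by (auto simp: chain_metric_def intro!: cInf_greatest)

lemma chain_metric_lessE:
  assumes "x \<in> X" "y \<in> X" "chain_metric X D x y < r"
  obtains s where "chain_sum X D x y s" "s < r"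
  using chain_metric_greatest[of x y r] assms by (meson not_le)

lemma chain_metric_le: "x \<in> X \<Longrightarrow> y \<in> X \<Longrightarrow> chain_metric X D x y \<le> D x y"
  by (intro chain_metric_le_sum chain_sum_single)

lemma chain_metric_close_imp_close:
  assumes "0 < \<epsilon>"
  shows "\<exists>\<delta>>0. \<forall>x\<in>X. \<forall>y\<in>X. chain_metric X D x y < \<delta> \<longrightarrow> D x y < \<epsilon>"
  using short_chain_imp_close[OF assms] chain_metric_lessE by metis

lemma Metric_space_chain_metric: "Metric_space X (chain_metric X D)"
proof
  fix x y
  show "0 \<le> chain_metric X D x y"
    using chain_metric_greatest chain_sum_nonneg by (cases "x \<in> X \<and> y \<in> X") (auto simp: chain_metric_def)
  have "chain_sum X D x y = chain_sum X D y x"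
    using chain_sum_reverse by blast
  then show "chain_metric X D x y = chain_metric X D y x"
    by (auto simp: chain_metric_def)
next
  fix x y assume xy: "x \<in> X" "y \<in> X"
  show "chain_metric X D x y = 0 \<longleftrightarrow> x = y"
  proof
    assume 0: "chain_metric X D x y = 0"
    have "D x y < \<epsilon>" if "0 < \<epsilon>" for \<epsilon>
      using chain_metric_close_imp_close[OF that] xy 0 by auto
    then have "D x y = 0" using nonneg[OF xy] by (metis less_irrefl order_le_less)
    then show "x = y" using zero[OF xy] by simp
  next
    assume "x = y"
    then have "chain_sum X D x y 0" using xy chain_sum.refl by simp
    then show "chain_metric X D x y = 0"
      using chain_metric_le_sum chain_metric_greatest[OF xy] chain_sum_nonneg by (metis order_antisym)
  qed
next
  fix x y z assume X: "x \<in> X" "y \<in> X" "z \<in> X"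
  have "chain_metric X D x z \<le> s + t" if "chain_sum X D x y s" "chain_sum X D y z t" for s t
    using chain_sum_concat[OF that(2,1)] by (rule chain_metric_le_sum)
  then have "chain_metric X D x z - t \<le> chain_metric X D x y" if "chain_sum X D y z t" for t
    using that X by (intro chain_metric_greatest) (auto simp: algebra_simps)
  then have "chain_metric X D x z - chain_metric X D x y \<le> chain_metric X D y z"
    using X by (intro chain_metric_greatest) (auto simp: algebra_simps)
  then show "chain_metric X D x z \<le> chain_metric X D x y + chain_metric X D y z"
    by simp
qed

lemma mtopology_chain_metric:
  "Metric_space.mtopology X (chain_metric X D) = F_topology X D"
proof -
  interpret d: Metric_space X "chain_metric X D" by (rule Metric_space_chain_metric)
  have small: "F_ball X D x r \<subseteq> d.mball x r" if "x \<in> X" for x r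
    using that chain_metric_le[of x] by (fastforce simp: F_ball_def)
  have large: "\<exists>\<delta>>0. d.mball x \<delta> \<subseteq> F_ball X D x r" if "0 < r" for x r
    using chain_metric_close_imp_close[OF that] by (fastforce simp: F_ball_def)
  have "openin d.mtopology V \<longleftrightarrow> F_open X D V" for V
    unfolding d.openin_mtopology F_open_def
    using small large by (meson order_trans subset_iff)
  then show ?thesis
    by (simp add: topology_eq openin_F_topology)
qed

end

theorem theorem2p1:
  fixes X :: "'a set" and D :: "'a \<Rightarrow> 'a \<Rightarrow> real"
    and f :: "real \<Rightarrow> real" and \<alpha> :: real
  assumes "F_metric_space X D f \<alpha>"
  shows "\<exists>d :: 'a \<Rightarrow> 'a \<Rightarrow> real.
           Metric_space X d \<and> Metric_space.mtopology X d = F_topology X D"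
  using F_metric_space.Metric_space_chain_metric[OF assms]
    F_metric_space.mtopology_chain_metric[OF assms] by blast

end
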